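(* Let $g\in\mathbb{N}$ with $g\equiv 4\pmod 6$ and let $k\ge 2$ be an integer. Let $G_k$ be a graph (bipartite, with girth at least $g$) obtained by the recursive construction with parameter $g$ described in the context. Then there is a $k$-list assignment $L$ on $G_k$ such that $|L(u)\cap L(v)|=1$ for every edge $uv\in E(G_k)$ and $G_k$ is not $L$-colorable.
   Context: Graphs are finite and simple; $\mathbb{N}$ is the set of positive integers. A $k$-list assignment $L$ on a graph $G$ assigns to each vertex $v$ a set $L(v)$ of exactly $k$ colors; $G$ is $L$-colorable if it has a proper coloring $f$ with $f(v)\in L(v)$ for all $v$. Augmented trees. A complete $d$-ary tree of height $m$ is a rooted tree in which every internal vertex has exactly $d$ children and every leaf is at distance $m$ from the root. An $r$-augmented tree is a graph consisting of a rooted tree (the underlying tree) plus, for each leaf, $r$ additional edges (augmenting edges) joining that leaf to $r$ distinct non-parent ancestors. A $(d,r,g)$-graph is a bipartite $r$-augmented complete $d$-ary tree with girth at least $g$; such graphs exist for all $d,r,g\in\mathbb{N}$. A full path is a path in the underlying tree from the root to a leaf. Reduced graphs. Given a $(d,r,g)$-graph with underlying tree $T_0$ and an ordering of the $d$ children at each internal vertex, color each edge of $T_0$ from a parent $x$ to a child $y$ with the index in $\{1,\dots,d\}$ of $y$ in the ordering of the children of $x$. The corresponding reduced $(d,r,g)$-graph is obtained by deleting, at each non-root internal vertex $v$ of $T_0$, the whole subtree under (reached by) the descending edge at $v$ whose color equals the color of the edge from $v$ to its parent (together with all augmenting edges at deleted leaves). Its underlying tree $T$ is what remains of $T_0$: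 each non-leaf vertex has degree $d$ in $T$. Construction of $G_k$ (with a designated root vertex), for fixed even $g\ge 4$. $G_2$ is the graph consisting of two cycles of length $g$ sharing exactly one vertex, which is the root. For $k\ge 3$, let $G_{k-1}$ be already constructed, with bipartition $(A,B)$ where $A$ contains its root; let $a=|A|-1$, $b=|B|$, $r=|V(G_{k-1})|-1=a+b$. Take a reduced $(k,r,2g)$-graph $H'$ with underlying tree $T$. For each leaf $v$ of $T$, let $A(v)$ be some set of $a$ of the $r$ augmenting edges at $v$; for each of the other $b$ augmenting edges at $v$, replace its ancestor endpoint by the vertex one step closer to $v$ along the full path to $v$, and let $B(v)$ be the resulting set of $b$ edges. Finally, for each leaf $v$ of $T$, add a copy of $G_{k-1}$, merging its root with $v$, and move the leaf endpoints of the edges in $A(v)\cup B(v)$ from $v$ into this copy so that each vertex of the copy corresponding to a non-root vertex of $A$ receives exactly one edge of $A(v)$, and each vertex corresponding to a vertex of $B$ receives exactly one edge of $B(v)$ (the edge of $T$ from $v$ to its parent is kept, and no augmenting edge remains at $v$). The resulting graph is $G_k$, and its root is the root of $T$. *)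

theory Defs
  imports Main "HOL-Library.Extended_Nat"
begin

section \<open>Finite simple graphs\<close>

type_synonym 'a ugraph = "'a set \<times> 'a set set"

abbreviation uverts :: "'a ugraph \<Rightarrow> 'a set" where "uverts \<equiv> fst"
abbreviation uedges :: "'a ugraph \<Rightarrow> 'a set set" where "uedges \<equiv> snd"

definition simple_graph :: "'a ugraph \<Rightarrow> bool" where
  "simple_graph G \<longleftrightarrow> finite (uverts G) \<and> (\<forall>e\<in>uedges G. e \<subseteq> uverts G \<and> card e = 2)"

definition induced_subgraph :: "'a ugraph \<Rightarrow> 'a set \<Rightarrow> 'a ugraph" where
  "induced_subgraph G W = (W, {e \<in> uedges G. e \<subseteq> W})"

definition upath :: "'a ugraph \<Rightarrow> 'a \<Rightarrow> 'a list \<Rightarrow> 'a \<Rightarrow> bool" where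
  "upath G u p v \<longleftrightarrow> p \<noteq> [] \<and> hd p = u \<and> last p = v \<and> distinct p \<and> set p \<subseteq> uverts G \<and>
     (\<forall>i. Suc i < length p \<longrightarrow> {p ! i, p ! Suc i} \<in> uedges G)"

definition cycle_edges :: "'a list \<Rightarrow> 'a set set" where
  "cycle_edges c = {{c ! i, c ! (Suc i mod length c)} |i. i < length c}"

definition ucycle :: "'a ugraph \<Rightarrow> 'a list \<Rightarrow> bool" where
  "ucycle G c \<longleftrightarrow> 3 \<le> length c \<and> distinct c \<and> set c \<subseteq> uverts G \<and> cycle_edges c \<subseteq> uedges G"

text \<open>The girth of an acyclic graph is \<open>\<infinity>\<close>.\<close>

definition girth :: "'a ugraph \<Rightarrow> enat" where
  "girth G = (INF c\<in>{c. ucycle G c}. enat (length c))"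

definition bipartition :: "'a ugraph \<Rightarrow> 'a set \<Rightarrow> 'a set \<Rightarrow> bool" where
  "bipartition G A B \<longleftrightarrow> A \<union> B = uverts G \<and> A \<inter> B = {} \<and>
     (\<forall>e\<in>uedges G. \<exists>x\<in>A. \<exists>y\<in>B. e = {x, y})"

definition bipartite :: "'a ugraph \<Rightarrow> bool" where
  "bipartite G \<longleftrightarrow> (\<exists>A B. bipartition G A B)"


section \<open>List colouring\<close>

definition list_assignment :: "nat \<Rightarrow> 'a ugraph \<Rightarrow> ('a \<Rightarrow> 'c set) \<Rightarrow> bool" where
  "list_assignment k G L \<longleftrightarrow> (\<forall>v\<in>uverts G. finite (L v) \<and> card (L v) = k)"

definition proper_coloring :: "'a ugraph \<Rightarrow> ('a \<Rightarrow> 'c) \<Rightarrow> bool" where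
  "proper_coloring G f \<longleftrightarrow>
     (\<forall>u\<in>uverts G. \<forall>v\<in>uverts G. {u, v} \<in> uedges G \<longrightarrow> f u \<noteq> f v)"

definition list_colorable :: "'a ugraph \<Rightarrow> ('a \<Rightarrow> 'c set) \<Rightarrow> bool" where
  "list_colorable G L \<longleftrightarrow> (\<exists>f. proper_coloring G f \<and> (\<forall>v\<in>uverts G. f v \<in> L v))"


section \<open>Rooted trees\<close>

definition utree :: "'a ugraph \<Rightarrow> bool" where
  "utree T \<longleftrightarrow> simple_graph T \<and> (\<forall>u\<in>uverts T. \<forall>v\<in>uverts T. \<exists>!p. upath T u p v)"

definition rooted_tree :: "'a ugraph \<Rightarrow> 'a \<Rightarrow> bool" where
  "rooted_tree T \<rho> \<longleftrightarrow> utree T \<and> \<rho> \<in> uverts T"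

text \<open>The path from the root to \<open>v\<close>; both ends are included.\<close>

definition root_path :: "'a ugraph \<Rightarrow> 'a \<Rightarrow> 'a \<Rightarrow> 'a list" where
  "root_path T \<rho> v = (THE p. upath T \<rho> p v)"

definition depth :: "'a ugraph \<Rightarrow> 'a \<Rightarrow> 'a \<Rightarrow> nat" where
  "depth T \<rho> v = length (root_path T \<rho> v) - 1"

definition ancestors :: "'a ugraph \<Rightarrow> 'a \<Rightarrow> 'a \<Rightarrow> 'a set" where
  "ancestors T \<rho> v = set (butlast (root_path T \<rho> v))"

text \<open>Meaningful only for \<open>v \<noteq> \<rho>\<close>.\<close>

definition parent :: "'a ugraph \<Rightarrow> 'a \<Rightarrow> 'a \<Rightarrow> 'a" where
  "parent T \<rho> v = last (butlast (root_path T \<rho> v))"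

definition children :: "'a ugraph \<Rightarrow> 'a \<Rightarrow> 'a \<Rightarrow> 'a set" where
  "children T \<rho> x = {y \<in> uverts T - {\<rho>}. parent T \<rho> y = x}"

definition leaves :: "'a ugraph \<Rightarrow> 'a \<Rightarrow> 'a set" where
  "leaves T \<rho> = {v \<in> uverts T. children T \<rho> v = {}}"

definition internals :: "'a ugraph \<Rightarrow> 'a \<Rightarrow> 'a set" where
  "internals T \<rho> = uverts T - leaves T \<rho>"

text \<open>The vertex set of the subtree rooted at \<open>x\<close>, including \<open>x\<close> itself.\<close>

definition subtree_verts :: "'a ugraph \<Rightarrow> 'a \<Rightarrow> 'a \<Rightarrow> 'a set" where
  "subtree_verts T \<rho> x = {y \<in> uverts T. x \<in> set (root_path T \<rho> y)}"

text \<open>For an ancestor \<open>u\<close> of \<open>v\<close>: the vertex one step closer to \<open>v\<close> on the path from \<open>u\<close> to \<open>v\<close>.\<close>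

definition step_towards :: "'a ugraph \<Rightarrow> 'a \<Rightarrow> 'a \<Rightarrow> 'a \<Rightarrow> 'a" where
  "step_towards T \<rho> v u =
     (THE w. \<exists>i. Suc i < length (root_path T \<rho> v) \<and>
        root_path T \<rho> v ! i = u \<and> root_path T \<rho> v ! Suc i = w)"

definition complete_ary_tree :: "nat \<Rightarrow> nat \<Rightarrow> 'a ugraph \<Rightarrow> 'a \<Rightarrow> bool" where
  "complete_ary_tree d m T \<rho> \<longleftrightarrow> rooted_tree T \<rho> \<and>
     (\<forall>x\<in>internals T \<rho>. card (children T \<rho> x) = d) \<and>
     (\<forall>v\<in>leaves T \<rho>. depth T \<rho> v = m)"


section \<open>Augmented and reduced trees\<close>

text \<open>
  An augmented tree is given by its underlying rooted tree and a function \<open>N\<close> that assigns to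
  each leaf the set of ancestor endpoints of its augmenting edges.  Values of \<open>N\<close> outside the
  leaves are irrelevant.
\<close>

definition augmented_tree :: "nat \<Rightarrow> 'a ugraph \<Rightarrow> 'a \<Rightarrow> ('a \<Rightarrow> 'a set) \<Rightarrow> bool" where
  "augmented_tree r T \<rho> N \<longleftrightarrow> rooted_tree T \<rho> \<and>
     (\<forall>v\<in>leaves T \<rho>. N v \<subseteq> ancestors T \<rho> v - {parent T \<rho> v} \<and> card (N v) = r)"

definition augmented_graph :: "'a ugraph \<Rightarrow> 'a \<Rightarrow> ('a \<Rightarrow> 'a set) \<Rightarrow> 'a ugraph" where
  "augmented_graph T \<rho> N =
     (uverts T, uedges T \<union> {{v, u} |v u. v \<in> leaves T \<rho> \<and> u \<in> N v})"

definition drg_graph :: "nat \<Rightarrow> nat \<Rightarrow> nat \<Rightarrow> 'a ugraph \<Rightarrow> 'a \<Rightarrow> ('a \<Rightarrow> 'a set) \<Rightarrow> bool" where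
  "drg_graph d r g T \<rho> N \<longleftrightarrow>
     (\<exists>m. complete_ary_tree d m T \<rho>) \<and> augmented_tree r T \<rho> N \<and>
     bipartite (augmented_graph T \<rho> N) \<and> enat g \<le> girth (augmented_graph T \<rho> N)"

text \<open>
  \<open>ix y\<close> is the index of \<open>y\<close> in the ordering of the children of its parent, that is, the colour
  of the edge joining \<open>y\<close> to its parent.
\<close>

definition child_ordering :: "nat \<Rightarrow> 'a ugraph \<Rightarrow> 'a \<Rightarrow> ('a \<Rightarrow> nat) \<Rightarrow> bool" where
  "child_ordering d T \<rho> ix \<longleftrightarrow> (\<forall>x\<in>internals T \<rho>. bij_betw ix (children T \<rho> x) {1..d})"

definition deleted_verts :: "'a ugraph \<Rightarrow> 'a \<Rightarrow> ('a \<Rightarrow> nat) \<Rightarrow> 'a set" where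
  "deleted_verts T \<rho> ix =
     (\<Union>v\<in>internals T \<rho> - {\<rho>}. \<Union>y\<in>{y \<in> children T \<rho> v. ix y = ix v}. subtree_verts T \<rho> y)"

text \<open>
  All ancestors of a surviving leaf survive, so the reduced graph is again given by a
  tree together with the same function \<open>N\<close>, now used only at the surviving leaves.
\<close>

definition reduced_drg_graph ::
    "nat \<Rightarrow> nat \<Rightarrow> nat \<Rightarrow> 'a ugraph \<Rightarrow> 'a \<Rightarrow> ('a \<Rightarrow> 'a set) \<Rightarrow> bool" where
  "reduced_drg_graph d r g T \<rho> N \<longleftrightarrow>
     (\<exists>T\<^sub>0 ix. drg_graph d r g T\<^sub>0 \<rho> N \<and> child_ordering d T\<^sub>0 \<rho> ix \<and>
        T = induced_subgraph T\<^sub>0 (uverts T\<^sub>0 - deleted_verts T\<^sub>0 \<rho> ix))"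


section \<open>The construction\<close>

definition two_cycles :: "nat \<Rightarrow> 'a ugraph \<Rightarrow> 'a \<Rightarrow> bool" where
  "two_cycles g G \<rho> \<longleftrightarrow>
     (\<exists>c\<^sub>1 c\<^sub>2. length c\<^sub>1 = g \<and> length c\<^sub>2 = g \<and> distinct c\<^sub>1 \<and> distinct c\<^sub>2 \<and>
        set c\<^sub>1 \<inter> set c\<^sub>2 = {\<rho>} \<and>
        G = (set c\<^sub>1 \<union> set c\<^sub>2, cycle_edges c\<^sub>1 \<union> cycle_edges c\<^sub>2))"

text \<open>
  \<open>attach_copies G' \<rho>' A B T \<rho> N G\<close>: the graph \<open>G\<close> arises from the augmented tree \<open>(T, \<rho>, N)\<close> by
  attaching a copy of \<open>G'\<close>, with root \<open>\<rho>'\<close> and bipartition \<open>(A, B)\<close>, at every leaf.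
  For a leaf \<open>v\<close>, \<open>\<phi> v\<close> embeds \<open>G'\<close> as the copy at \<open>v\<close>, and \<open>SA v\<close> and \<open>SB v\<close> are the sets of
  ancestor endpoints of the edges in \<open>A(v)\<close> and \<open>B(v)\<close>.  The bijections \<open>\<alpha> v\<close> and \<open>\<beta> v\<close> tell
  which of these edges each vertex of the copy receives.
\<close>

definition attach_copies ::
    "'a ugraph \<Rightarrow> 'a \<Rightarrow> 'a set \<Rightarrow> 'a set \<Rightarrow> 'a ugraph \<Rightarrow> 'a \<Rightarrow> ('a \<Rightarrow> 'a set) \<Rightarrow> 'a ugraph \<Rightarrow> bool"
  where
  "attach_copies G' \<rho>' A B T \<rho> N G \<longleftrightarrow>
     (\<exists>\<phi> SA SB \<alpha> \<beta>.
        (\<forall>v\<in>leaves T \<rho>.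
           inj_on (\<phi> v) (uverts G') \<and> \<phi> v \<rho>' = v \<and>
           \<phi> v ` (uverts G' - {\<rho>'}) \<inter> uverts T = {} \<and>
           SA v \<subseteq> N v \<and> card (SA v) = card A - 1 \<and>
           SB v = step_towards T \<rho> v ` (N v - SA v) \<and>
           bij_betw (\<alpha> v) (A - {\<rho>'}) (SA v) \<and> bij_betw (\<beta> v) B (SB v)) \<and>
        (\<forall>v\<in>leaves T \<rho>. \<forall>w\<in>leaves T \<rho>. v \<noteq> w \<longrightarrow> \<phi> v ` uverts G' \<inter> \<phi> w ` uverts G' = {}) \<and>
        G = (uverts T \<union> (\<Union>v\<in>leaves T \<rho>. \<phi> v ` uverts G'),
             uedges T \<union>
             (\<Union>v\<in>leaves T \<rho>. (\<lambda>e. \<phi> v ` e) ` uedges G' \<union>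
                {{\<phi> v x, \<alpha> v x} |x. x \<in> A - {\<rho>'}} \<union> {{\<phi> v y, \<beta> v y} |y. y \<in> B})))"

text \<open>
  \<open>construction g k G \<rho>\<close>: the graph \<open>G\<close> with root \<open>\<rho>\<close> is a possible outcome \<open>G\<^sub>k\<close> of the
  recursive construction with parameter \<open>g\<close>.
\<close>

inductive construction :: "nat \<Rightarrow> nat \<Rightarrow> 'a ugraph \<Rightarrow> 'a \<Rightarrow> bool" for g :: nat where
  base: "two_cycles g G \<rho> \<Longrightarrow> construction g 2 G \<rho>"
| step: "\<lbrakk>3 \<le> k; construction g (k - 1) G' \<rho>'; bipartition G' A B; \<rho>' \<in> A;
          reduced_drg_graph k (card (uverts G') - 1) (2 * g) T \<rho> N;
          attach_copies G' \<rho>' A B T \<rho> N G\<rbrakk>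
         \<Longrightarrow> construction g k G \<rho>"

end

theory Submission
  imports Defs
begin

text \<open>
  The lists are built along the recursive construction.  On \<open>G\<^sub>2\<close> the root has a list of two
  colours, and each of the two cycles rules out one of them: if the lists along the remaining
  vertices of a cycle are \<open>{x\<^sub>0, x\<^sub>1}, {x\<^sub>1, x\<^sub>2}, \<dots>, {x\<^sub>n\<^sub>-\<^sub>1, x\<^sub>0}\<close>, then giving \<open>x\<^sub>0\<close> to the root forces
  \<open>x\<^sub>1, x\<^sub>2, \<dots>\<close> in turn and finally \<open>x\<^sub>0\<close> on the last vertex, a neighbour of the root
  (\<open>two_cycles_not_list_colorable\<close>).

  In the step from \<open>G\<^sub>k\<^sub>-\<^sub>1\<close> to \<open>G\<^sub>k\<close> every edge of the underlying tree \<open>T\<close> gets a colour of its own,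
  and the list of an internal vertex consists of the colours of its \<open>k\<close> incident tree edges.  Adjacent
  internal vertices then share exactly the colour of the edge between them.  In a proper
  colouring every internal vertex selects one of its tree edges and no edge is selected from both
  ends, so following the selected edges from the root gives a full path, to a leaf \<open>v\<close> say, on which every
  vertex has the colour of the next edge (\<open>coloring_follows_full_path\<close>).  A vertex \<open>x\<close> of the copy of
  \<open>G\<^sub>k\<^sub>-\<^sub>1\<close> at \<open>v\<close> has exactly one neighbour on that path outside the copy; its list is the \<open>(k - 1)\<close>-list
  from \<open>G\<^sub>k\<^sub>-\<^sub>1\<close> together with the colour of the path edge below that neighbour.  The neighbour has taken
  this extra colour, so the copy would be coloured from the lists of \<open>G\<^sub>k\<^sub>-\<^sub>1\<close>, which is impossible
  (\<open>attach_copies_not_list_colorable\<close>).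

  Adjacent vertices of a copy must receive different extra colours.  The augmenting edges at \<open>v\<close> lead to
  distinct ancestors, but the shift of the edges in \<open>B(v)\<close> could move an endpoint onto the parent of \<open>v\<close> or
  onto the endpoint of an edge in \<open>A(v)\<close>.  Bipartiteness excludes this: all augmenting edges at \<open>v\<close> lead to
  ancestors at odd distance from \<open>v\<close>, so the edges of \<open>A(v)\<close>, like the edge from \<open>v\<close> to its parent, end at
  odd distance, while the shifted edges end at even distance.
\<close>

section \<open>Trees seen from the root\<close>

text \<open>
  Uniqueness is asked only for paths from the root: unlike the existence of paths between arbitrary
  vertices, this passes directly to ancestor-closed sets of vertices, hence to reduced trees.
\<close>

definition uniquely_rooted :: "'a ugraph \<Rightarrow> 'a \<Rightarrow> bool" where
  "uniquely_rooted T \<rho> \<longleftrightarrow>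
     simple_graph T \<and> \<rho> \<in> uverts T \<and> (\<forall>v\<in>uverts T. \<exists>!p. upath T \<rho> p v)"

lemma rooted_tree_uniquely_rooted: "rooted_tree T \<rho> \<Longrightarrow> uniquely_rooted T \<rho>"
  by (auto simp: rooted_tree_def utree_def uniquely_rooted_def)

lemma upath_last_in: "upath G u p v \<Longrightarrow> v \<in> uverts G"
  using last_in_set[of p] by (auto simp: upath_def)

lemma upath_take:
  assumes "upath G u p v" "i < length p"
  shows "upath G u (take (Suc i) p) (p ! i)"
  unfolding upath_def
proof (intro conjI allI impI)
  show "last (take (Suc i) p) = p ! i"
    using assms(2) by (simp add: take_Suc_conv_app_nth)
  show "set (take (Suc i) p) \<subseteq> uverts G"
    using assms(1) set_take_subset[of "Suc i" p] by (auto simp: upath_def)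
qed (use assms in \<open>simp_all add: upath_def hd_take\<close>)

lemma upath_snoc:
  assumes "upath G u p v" "w \<notin> set p" "w \<in> uverts G" "{v, w} \<in> uedges G"
  shows "upath G u (p @ [w]) w"
  unfolding upath_def
proof (intro conjI allI impI)
  show "{(p @ [w]) ! i, (p @ [w]) ! Suc i} \<in> uedges G" if "Suc i < length (p @ [w])" for i
  proof (cases "Suc i < length p")
    case True
    then show ?thesis using assms by (simp add: upath_def nth_append)
  next
    case False
    then have "length p = Suc i" using that by simp
    then show ?thesis using assms by (auto simp: upath_def nth_append last_conv_nth)
  qed
  show "hd (p @ [w]) = u" using assms(1) by (simp add: upath_def)
  show "distinct (p @ [w])" using assms(1,2) by (simp add: upath_def)
  show "set (p @ [w]) \<subseteq> uverts G" using assms(1,3) by (simp add: upath_def)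
qed simp_all

context
  fixes T :: "'a ugraph" and \<rho> :: 'a
  assumes T: "uniquely_rooted T \<rho>"
begin

lemma root_path_eqI: "upath T \<rho> p v \<Longrightarrow> root_path T \<rho> v = p"
  using T upath_last_in[of T \<rho> p v] unfolding root_path_def uniquely_rooted_def
  by (metis (no_types, lifting) the_equality)

lemma upath_root_path: "v \<in> uverts T \<Longrightarrow> upath T \<rho> (root_path T \<rho> v) v"
  using T theI'[of "\<lambda>p. upath T \<rho> p v"] by (simp add: root_path_def uniquely_rooted_def)

lemma root_path_root: "root_path T \<rho> \<rho> = [\<rho>]"
  using T by (intro root_path_eqI) (auto simp: upath_def uniquely_rooted_def)

lemma root_path_nth:
  assumes "v \<in> uverts T" "i < length (root_path T \<rho> v)"
  shows "root_path T \<rho> (root_path T \<rho> v ! i) = take (Suc i) (root_path T \<rho> v)"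
  using upath_take[OF upath_root_path[OF assms(1)] assms(2)] by (rule root_path_eqI)

lemma set_root_path_subset: "v \<in> uverts T \<Longrightarrow> set (root_path T \<rho> v) \<subseteq> uverts T"
  using upath_root_path[of v] by (simp add: upath_def)

lemma in_root_path_trans:
  assumes "v \<in> uverts T" "z \<in> set (root_path T \<rho> v)" "y \<in> set (root_path T \<rho> z)"
  shows "y \<in> set (root_path T \<rho> v)"
proof -
  obtain i where "i < length (root_path T \<rho> v)" "root_path T \<rho> v ! i = z"
    using assms(2) by (auto simp: in_set_conv_nth)
  then show ?thesis using assms(3) root_path_nth[OF assms(1)] by (metis in_set_takeD)
qed

lemma nonroot:
  assumes "y \<in> uverts T" "y \<noteq> \<rho>"
  shows root_path_nonroot: "root_path T \<rho> y = root_path T \<rho> (parent T \<rho> y) @ [y]"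
    and parent_in: "parent T \<rho> y \<in> uverts T"
    and parent_edge: "{parent T \<rho> y, y} \<in> uedges T"
proof -
  let ?p = "root_path T \<rho> y"
  have up: "upath T \<rho> ?p y" by (rule upath_root_path[OF assms(1)])
  then have ne: "?p \<noteq> []" "hd ?p = \<rho>" "last ?p = y" by (auto simp: upath_def)
  have "length ?p \<noteq> 1"
  proof
    assume "length ?p = 1"
    then obtain x where "?p = [x]" by (auto simp: length_Suc_conv)
    then show False using ne(2,3) assms(2) by simp
  qed
  then have len: "2 \<le> length ?p" using ne(1) by (simp add: numeral_2_eq_2 Suc_le_eq nat_neq_iff)
  define i where "i = length ?p - 2"
  have i: "Suc i < length ?p" "Suc (Suc i) = length ?p" using len by (auto simp: i_def)
  have lb: "length (butlast ?p) = Suc i" using i(2) by simp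
  then have "butlast ?p \<noteq> []" by (metis list.size(3) nat.distinct(1))
  then have "last (butlast ?p) = butlast ?p ! i"
    using last_conv_nth[of "butlast ?p"] unfolding lb diff_Suc_1 by blast
  also have "\<dots> = ?p ! i" by (rule nth_butlast) (simp only: lb lessI)
  finally have par: "parent T \<rho> y = ?p ! i" by (simp only: parent_def)
  have y: "?p ! Suc i = y" 
    using last_conv_nth[OF ne(1)] ne(3) unfolding i(2)[symmetric] diff_Suc_1 by simp
  show "parent T \<rho> y \<in> uverts T"
    using up i(1) by (auto simp: par upath_def)
  show "{parent T \<rho> y, y} \<in> uedges T" using up i(1) y by (auto simp: par upath_def)
  have "root_path T \<rho> (parent T \<rho> y) = take (Suc i) ?p"
    unfolding par using root_path_nth[OF assms(1)] i(1) by simp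
  then show "?p = root_path T \<rho> (parent T \<rho> y) @ [y]"
    using take_Suc_conv_app_nth[OF i(1)] i(2) y by (metis order_refl take_all)
qed

lemma parent_snoc:
  assumes "root_path T \<rho> y = root_path T \<rho> u @ [y]" "u \<in> uverts T"
  shows "parent T \<rho> y = u"
  using assms upath_root_path[of u] by (simp add: parent_def upath_def)

lemma root_path_parent_nth:
  assumes "v \<in> uverts T" "Suc i < length (root_path T \<rho> v)"
  shows "root_path T \<rho> v ! Suc i \<in> children T \<rho> (root_path T \<rho> v ! i)"
proof -
  let ?p = "root_path T \<rho> v"
  have up: "upath T \<rho> ?p v" by (rule upath_root_path[OF assms(1)])
  have V: "?p ! i \<in> uverts T" "?p ! Suc i \<in> uverts T"
    using set_root_path_subset[OF assms(1)] assms(2) by auto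
  have "root_path T \<rho> (?p ! Suc i) = root_path T \<rho> (?p ! i) @ [?p ! Suc i]"
    using root_path_nth[OF assms(1)] assms(2) by (simp add: take_Suc_conv_app_nth)
  then have par: "parent T \<rho> (?p ! Suc i) = ?p ! i" using V by (intro parent_snoc)
  have "?p ! 0 = \<rho>" using up by (metis upath_def hd_conv_nth)
  moreover have "?p ! Suc i \<noteq> ?p ! 0"
    using up assms(2) nth_eq_iff_index_eq[of ?p "Suc i" 0] by (simp add: upath_def)
  ultimately show ?thesis using par V by (simp add: children_def)
qed

lemma step_towards_nth:
  assumes "v \<in> uverts T" "Suc i < length (root_path T \<rho> v)"
  shows "step_towards T \<rho> v (root_path T \<rho> v ! i) = root_path T \<rho> v ! Suc i"
proof -
  have "distinct (root_path T \<rho> v)" using upath_root_path[OF assms(1)] by (simp add: upath_def)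
  then have "j = i" if "Suc j < length (root_path T \<rho> v)"
      "root_path T \<rho> v ! j = root_path T \<rho> v ! i" for j
    using that assms(2) nth_eq_iff_index_eq[of "root_path T \<rho> v" j i] by simp
  then show ?thesis unfolding step_towards_def using assms(2)
    by (intro the_equality) blast+
qed

text \<open>
  If the root path of one end avoids the other end, it can be prolonged along the edge, and by
  uniqueness the result is the root path of the other end.  One of the two ends always has this
  property: if the root path of \<open>u\<close> contains \<open>v\<close>, then the root path of \<open>v\<close> is a proper prefix of it.
\<close>

lemma edge_parent_child:
  assumes "e \<in> uedges T"
  obtains y where "y \<in> uverts T" "y \<noteq> \<rho>" "e = {parent T \<rho> y, y}"
proof -
  have sg: "simple_graph T" using T by (simp add: uniquely_rooted_def)
  obtain u v where e: "e = {u, v}" "u \<noteq> v"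
    using sg assms unfolding simple_graph_def by (metis card_2_iff)
  have V: "u \<in> uverts T" "v \<in> uverts T" using sg assms e by (auto simp: simple_graph_def)
  have extend: "parent T \<rho> b = a \<and> b \<noteq> \<rho>"
    if ab: "a \<in> uverts T" "b \<in> uverts T" "{a, b} \<in> uedges T" "b \<notin> set (root_path T \<rho> a)" for a b
  proof -
    have up: "upath T \<rho> (root_path T \<rho> a) a" by (rule upath_root_path[OF ab(1)])
    have "root_path T \<rho> b = root_path T \<rho> a @ [b]"
      using upath_snoc[OF up ab(4,2,3)] by (rule root_path_eqI)
    moreover have "\<rho> \<in> set (root_path T \<rho> a)" using up by (metis upath_def hd_in_set)
    ultimately show ?thesis using parent_snoc ab by metis
  qed
  show ?thesis
  proof (cases "v \<in> set (root_path T \<rho> u)")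
    case False
    then show ?thesis using extend[of u v] V e assms that[of v] by auto
  next
    case True
    then obtain i where i: "i < length (root_path T \<rho> u)" "root_path T \<rho> u ! i = v"
      by (auto simp: in_set_conv_nth)
    have up: "upath T \<rho> (root_path T \<rho> u) u" by (rule upath_root_path[OF V(1)])
    have rv: "root_path T \<rho> v = take (Suc i) (root_path T \<rho> u)"
      using root_path_nth[OF V(1) i(1)] i(2) by simp
    have "u \<notin> set (root_path T \<rho> v)"
    proof
      assume "u \<in> set (root_path T \<rho> v)"
      then obtain j where j: "j \<le> i" "root_path T \<rho> u ! j = u"
        using i(1) by (auto simp: rv in_set_conv_nth less_Suc_eq_le)
      have "root_path T \<rho> u ! (length (root_path T \<rho> u) - 1) = u"
        using up by (metis last_conv_nth upath_def)
      then have "j = length (root_path T \<rho> u) - 1"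
        using j i(1) up nth_eq_iff_index_eq[of "root_path T \<rho> u" j "length (root_path T \<rho> u) - 1"]
        by (auto simp: upath_def)
      then have "i = j" using i(1) j(1) by simp
      then show False using i(2) j(2) e(2) by simp
    qed
    moreover have "{v, u} \<in> uedges T" using assms e by (simp add: insert_commute)
    ultimately show ?thesis
      using extend[of v u] V e that[of u] by (auto simp: insert_commute)
  qed
qed

lemma parent_not_self: "y \<in> uverts T \<Longrightarrow> y \<noteq> \<rho> \<Longrightarrow> parent T \<rho> y \<noteq> y"
  using root_path_nonroot[of y] by (metis append_self_conv not_Cons_self2)

lemma grandparent_not_self:
  assumes "y \<in> uverts T" "y \<noteq> \<rho>" "parent T \<rho> y \<noteq> \<rho>"
  shows "parent T \<rho> (parent T \<rho> y) \<noteq> y"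
proof
  assume "parent T \<rho> (parent T \<rho> y) = y"
  then have "length (root_path T \<rho> (parent T \<rho> y)) = Suc (length (root_path T \<rho> y))"
    using root_path_nonroot[OF parent_in] assms by simp
  moreover have "length (root_path T \<rho> y) = Suc (length (root_path T \<rho> (parent T \<rho> y)))"
    using arg_cong[OF root_path_nonroot[of y], of length] assms by simp
  ultimately show False by simp
qed

text \<open>
  The walk along a full path of a bipartite graph alternates between the two classes, so an edge
  between two of its vertices spans an odd distance.
\<close>

lemma root_path_edge_parity:
  assumes v: "v \<in> uverts T" and bip: "bipartition G P Q" and sub: "uedges T \<subseteq> uedges G"
    and i: "i < length (root_path T \<rho> v)" and j: "j < length (root_path T \<rho> v)"
    and e: "{root_path T \<rho> v ! i, root_path T \<rho> v ! j} \<in> uedges G"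
  shows "odd (i + j)"
proof -
  let ?p = "root_path T \<rho> v"
  have cross: "x \<in> P \<longleftrightarrow> y \<notin> P" if "{x, y} \<in> uedges G" for x y
    using bip that unfolding bipartition_def by (fastforce simp: doubleton_eq_iff)
  have alt: "?p ! n \<in> P \<longleftrightarrow> (even n \<longleftrightarrow> ?p ! 0 \<in> P)" if "n < length ?p" for n
    using that
  proof (induction n)
    case (Suc n)
    have "{?p ! n, ?p ! Suc n} \<in> uedges G"
      using upath_root_path[OF v] sub Suc.prems by (auto simp: upath_def)
    then show ?case using cross Suc by auto
  qed simp
  show ?thesis using cross[OF e] alt[OF i] alt[OF j] by auto
qed

end


section \<open>The reduced tree\<close>

lemma uniquely_rooted_ancestor_closed:
  assumes T: "uniquely_rooted T \<rho>" and W: "W \<subseteq> uverts T" "\<rho> \<in> W"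
    and closed: "\<And>x. x \<in> W \<Longrightarrow> set (root_path T \<rho> x) \<subseteq> W"
  shows "uniquely_rooted (induced_subgraph T W) \<rho>"
    and "\<And>x. x \<in> W \<Longrightarrow> root_path (induced_subgraph T W) \<rho> x = root_path T \<rho> x"
proof -
  let ?S = "induced_subgraph T W"
  have ex: "upath ?S \<rho> (root_path T \<rho> x) x" if "x \<in> W" for x
    using upath_root_path[OF T, of x] closed[OF that] W that
    by (auto simp: upath_def induced_subgraph_def)
  have "upath T \<rho> p x" if "upath ?S \<rho> p x" for p x
    using that W by (auto simp: upath_def induced_subgraph_def)
  then have un: "p = root_path T \<rho> x" if "upath ?S \<rho> p x" for p x
    using that root_path_eqI[OF T] by metis
  show "uniquely_rooted ?S \<rho>"
    unfolding uniquely_rooted_def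
  proof (intro conjI ballI)
    show "simple_graph ?S"
      using T W finite_subset
      by (auto simp: uniquely_rooted_def simple_graph_def induced_subgraph_def)
    show "\<exists>!p. upath ?S \<rho> p v" if "v \<in> uverts ?S" for v
      using that ex[of v] un by (auto simp: induced_subgraph_def)
  qed (use W in \<open>simp add: induced_subgraph_def\<close>)
  then show "root_path ?S \<rho> x = root_path T \<rho> x" if "x \<in> W" for x
    using root_path_eqI ex[OF that] by metis
qed

text \<open>
  A non-root internal vertex \<open>v\<close> is itself a child, so \<open>ix v\<close> lies in the range of the indices of its
  children and exactly one of them is deleted; since \<open>k \<ge> 3\<close>, no internal vertex turns into a leaf.  The last clause
  combines bipartiteness with the exclusion of the parent: an augmenting edge at a leaf reaches an
  ancestor at odd distance at least three.  The lower bound \<open>0 < r\<close> keeps the root from being a leaf.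
\<close>

lemma reduced_drg_graph_structure:
  assumes red: "reduced_drg_graph k r g T \<rho> N" and k: "3 \<le> k" and r: "0 < r"
  shows "uniquely_rooted T \<rho>"
    and "\<rho> \<in> internals T \<rho>"
    and "card (children T \<rho> \<rho>) = k"
    and "\<And>u. u \<in> internals T \<rho> \<Longrightarrow> u \<noteq> \<rho> \<Longrightarrow> card (children T \<rho> u) = k - 1"
    and "\<And>v u. v \<in> leaves T \<rho> \<Longrightarrow> u \<in> N v \<Longrightarrow>
           \<exists>i. u = root_path T \<rho> v ! i \<and> i + 3 < length (root_path T \<rho> v) \<and>
             even (length (root_path T \<rho> v) + i)"
proof -
  obtain T0 ix where drg: "drg_graph k r g T0 \<rho> N" and ord: "child_ordering k T0 \<rho> ix"
    and T: "T = induced_subgraph T0 (uverts T0 - deleted_verts T0 \<rho> ix)"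
    using red by (auto simp: reduced_drg_graph_def)
  define D where "D = deleted_verts T0 \<rho> ix"
  define W where "W = uverts T0 - D"
  have TW: "T = induced_subgraph T0 W" "uverts T = W"
    by (simp_all add: T W_def D_def induced_subgraph_def)
  have aug: "augmented_tree r T0 \<rho> N" using drg by (simp add: drg_graph_def)
  then have T0: "uniquely_rooted T0 \<rho>"
    by (simp add: augmented_tree_def rooted_tree_uniquely_rooted)
  obtain P Q where bip: "bipartition (augmented_graph T0 \<rho> N) P Q"
    using drg by (auto simp: drg_graph_def bipartite_def)
  have cardc: "card (children T0 \<rho> x) = k" if "x \<in> internals T0 \<rho>" for x
    using drg that by (auto simp: drg_graph_def complete_ary_tree_def)
  have \<rho>: "\<rho> \<in> uverts T0" using T0 by (simp add: uniquely_rooted_def)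
  have D_iff: "x \<in> D \<longleftrightarrow> x \<in> uverts T0 \<and> (\<exists>y\<in>set (root_path T0 \<rho> x).
      y \<in> uverts T0 \<and> y \<noteq> \<rho> \<and> parent T0 \<rho> y \<in> internals T0 \<rho> - {\<rho>} \<and> ix y = ix (parent T0 \<rho> y))" for x
    by (auto simp: D_def deleted_verts_def subtree_verts_def children_def)
  have \<rho>W: "\<rho> \<in> W" using \<rho> by (auto simp: W_def D_iff root_path_root[OF T0])
  have closed: "set (root_path T0 \<rho> x) \<subseteq> W" if x: "x \<in> W" for x
  proof
    fix z assume z: "z \<in> set (root_path T0 \<rho> x)"
    have xV: "x \<in> uverts T0" using x by (simp add: W_def)
    have "z \<in> uverts T0" using set_root_path_subset[OF T0 xV] z by auto
    moreover have "x \<notin> D" using x by (simp add: W_def)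
    then have "z \<notin> D"
      using xV in_root_path_trans[OF T0 xV z] by (simp only: D_iff) blast
    ultimately show "z \<in> W" by (simp add: W_def)
  qed
  have WV: "W \<subseteq> uverts T0" by (auto simp: W_def)
  show T': "uniquely_rooted T \<rho>"
    unfolding TW using uniquely_rooted_ancestor_closed(1)[OF T0 WV \<rho>W closed] by simp
  have rp: "root_path T \<rho> x = root_path T0 \<rho> x" if "x \<in> W" for x
    unfolding TW using uniquely_rooted_ancestor_closed(2)[OF T0 WV \<rho>W closed that] by simp
  have par: "parent T \<rho> x = parent T0 \<rho> x" if "x \<in> W" for x
    using rp[OF that] by (simp add: parent_def)
  have internal_parent: "parent T0 \<rho> y \<in> internals T0 \<rho>" if "y \<in> uverts T0" "y \<noteq> \<rho>" for y
    using parent_in[OF T0 that] that by (auto simp: internals_def leaves_def children_def)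
  have ch: "children T \<rho> u = {y \<in> children T0 \<rho> u. u \<noteq> \<rho> \<longrightarrow> ix y \<noteq> ix u}" if u: "u \<in> W" for u
  proof -
    have "y \<in> W \<longleftrightarrow> (u \<noteq> \<rho> \<longrightarrow> ix y \<noteq> ix u)" if y: "y \<in> children T0 \<rho> u" for y
    proof -
      have y': "y \<in> uverts T0" "y \<noteq> \<rho>" "parent T0 \<rho> y = u" using y by (auto simp: children_def)
      have "root_path T0 \<rho> y = root_path T0 \<rho> u @ [y]" using root_path_nonroot[OF T0 y'(1,2)] y' by simp
      then show ?thesis
        using u y' internal_parent[OF y'(1,2)] by (auto simp: W_def D_iff)
    qed
    moreover have "children T \<rho> u = children T0 \<rho> u \<inter> W"
      using par WV by (auto simp: children_def TW(2))
    ultimately show ?thesis by blast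
  qed
  have cards: "card (children T \<rho> u) = (if u = \<rho> then k else k - 1)"
    if u: "u \<in> W" "u \<in> internals T0 \<rho>" for u
  proof (cases "u = \<rho>")
    case True
    then show ?thesis using ch[OF u(1)] cardc[OF u(2)] by simp
  next
    case False
    have bij: "bij_betw ix (children T0 \<rho> u) {1..k}" using ord u by (simp add: child_ordering_def)
    have uV: "u \<in> uverts T0" using u(1) WV by auto
    have "u \<in> children T0 \<rho> (parent T0 \<rho> u)" using uV False by (simp add: children_def)
    then have "ix u \<in> {1..k}"
      using ord internal_parent[OF uV False] unfolding child_ordering_def by (meson bij_betwE)
    moreover have "children T \<rho> u = children T0 \<rho> u \<inter> (ix -` ({1..k} - {ix u}))"
      using bij ch[OF u(1)] False by (auto simp: bij_betw_def)
    then have "ix ` children T \<rho> u = ix ` children T0 \<rho> u \<inter> ({1..k} - {ix u})" by auto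
    then have "ix ` children T \<rho> u = {1..k} - {ix u}"
      using bij by (auto simp: bij_betw_def)
    moreover have "inj_on ix (children T \<rho> u)"
      using bij ch[OF u(1)] by (auto simp: bij_betw_def inj_on_def)
    ultimately show ?thesis using False card_image[of ix "children T \<rho> u"] by simp
  qed
  have leaf: "v \<in> leaves T0 \<rho> \<and> v \<in> W" if "v \<in> leaves T \<rho>" for v
  proof -
    have v: "v \<in> W" "children T \<rho> v = {}" using that by (auto simp: leaves_def TW(2))
    have "v \<notin> internals T0 \<rho>"
    proof
      assume "v \<in> internals T0 \<rho>"
      then have "(if v = \<rho> then k else k - 1) = 0" using cards[OF v(1)] v(2) by simp
      then show False using k by (simp split: if_splits)
    qed
    then show ?thesis using v(1) WV by (auto simp: internals_def)
  qed
  have "\<rho> \<notin> leaves T0 \<rho>"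
  proof
    assume "\<rho> \<in> leaves T0 \<rho>"
    then have "N \<rho> \<subseteq> ancestors T0 \<rho> \<rho>" "card (N \<rho>) = r" using aug by (auto simp: augmented_tree_def)
    then show False using r by (simp add: ancestors_def root_path_root[OF T0])
  qed
  then have \<rho>int: "\<rho> \<in> internals T0 \<rho>" using \<rho> by (simp add: internals_def)
  show cr: "card (children T \<rho> \<rho>) = k" using cards[OF \<rho>W \<rho>int] by simp
  show "\<rho> \<in> internals T \<rho>" using cr k \<rho>W by (auto simp: internals_def leaves_def TW(2))
  show "card (children T \<rho> u) = k - 1" if "u \<in> internals T \<rho>" "u \<noteq> \<rho>" for u
  proof -
    have u: "u \<in> W" "children T \<rho> u \<noteq> {}" using that by (auto simp: internals_def leaves_def TW(2))
    then have "u \<in> internals T0 \<rho>" using ch WV by (auto simp: internals_def leaves_def)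
    then show ?thesis using cards[OF u(1)] that(2) by simp
  qed
  show "\<exists>i. u = root_path T \<rho> v ! i \<and> i + 3 < length (root_path T \<rho> v) \<and>
             even (length (root_path T \<rho> v) + i)" if v: "v \<in> leaves T \<rho>" and u: "u \<in> N v" for v u
  proof -
    let ?p = "root_path T0 \<rho> v"
    have vl: "v \<in> leaves T0 \<rho>" and vW: "v \<in> W" using leaf[OF v] by auto
    then have vV: "v \<in> uverts T0" using WV by auto
    have up: "upath T0 \<rho> ?p v" by (rule upath_root_path[OF T0 vV])
    then have last: "?p \<noteq> []" "?p ! (length ?p - 1) = v" by (auto simp: upath_def last_conv_nth)
    have ub: "u \<in> set (butlast ?p)" and npar: "u \<noteq> parent T0 \<rho> v"
      using aug vl u by (auto simp: augmented_tree_def ancestors_def)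
    then obtain i where i: "i < length ?p - 1" "u = ?p ! i"
      by (auto simp: in_set_conv_nth nth_butlast)
    have "butlast ?p \<noteq> []" using ub by auto
    then have "parent T0 \<rho> v = ?p ! (length ?p - 2)"
      using i(1) by (simp add: parent_def last_conv_nth nth_butlast numeral_2_eq_2)
    then have i': "i \<noteq> length ?p - 2" using npar i(2) by auto
    have "{v, u} \<in> uedges (augmented_graph T0 \<rho> N)" using vl u by (auto simp: augmented_graph_def)
    then have "odd (length ?p - 1 + i)"
      using root_path_edge_parity[OF T0 vV bip, of "length ?p - 1" i] last i
      by (auto simp: augmented_graph_def)
    then have even: "even (length ?p + i)" using i(1) by presburger
    then have "i + 3 \<noteq> length ?p" by presburger
    then have "i + 3 < length ?p" using i(1) i' by linarith
    then show ?thesis using i(2) rp[OF vW] even by auto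
  qed
qed


section \<open>Lists on the tree\<close>

text \<open>
  An edge of the tree is named by its lower end, so that a vertex \<open>u\<close> other than the root stands for the
  edge from \<open>u\<close> to its parent.
\<close>

definition edge_labels :: "'a ugraph \<Rightarrow> 'a \<Rightarrow> 'a \<Rightarrow> 'a set" where
  "edge_labels T \<rho> u = children T \<rho> u \<union> ({u} - {\<rho>})"

lemma edge_labels_Int_parent:
  assumes "uniquely_rooted T \<rho>" "y \<in> uverts T" "y \<noteq> \<rho>"
  shows "edge_labels T \<rho> (parent T \<rho> y) \<inter> edge_labels T \<rho> y = {y}"
  using parent_not_self[OF assms] grandparent_not_self[OF assms] assms(2,3)
  by (auto simp: edge_labels_def children_def)

lemma card_edge_labels:
  assumes "uniquely_rooted T \<rho>" "0 < k"
    and "card (children T \<rho> u) = (if u = \<rho> then k else k - 1)"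
  shows "card (edge_labels T \<rho> u) = k"
proof -
  have fin: "finite (children T \<rho> u)"
    using assms(1) by (simp add: uniquely_rooted_def simple_graph_def children_def)
  have notin: "u \<notin> children T \<rho> u"
    using parent_not_self[OF assms(1), of u] by (auto simp: children_def)
  show ?thesis
  proof (cases "u = \<rho>")
    case True
    then show ?thesis using assms(3) by (simp add: edge_labels_def)
  next
    case False
    then have "edge_labels T \<rho> u = insert u (children T \<rho> u)" by (auto simp: edge_labels_def)
    then show ?thesis using card_insert_disjoint[OF fin notin] False assms(2,3) by simp
  qed
qed

text \<open>
  Read the colour of an internal vertex as a choice of an edge at that vertex.  The root chooses an
  edge leading down, and a vertex entered through the edge chosen by its parent cannot choose that
  edge again, so the choices lead from the root down to a leaf.
\<close>

lemma coloring_follows_full_path: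
  assumes T: "uniquely_rooted T \<rho>"
    and proper: "\<And>u v. {u, v} \<in> uedges T \<Longrightarrow> f u \<noteq> f v"
    and lists: "\<And>u. u \<in> internals T \<rho> \<Longrightarrow> f u \<in> col ` edge_labels T \<rho> u"
  obtains v where "v \<in> leaves T \<rho>"
    "\<And>i. Suc i < length (root_path T \<rho> v) \<Longrightarrow>
       f (root_path T \<rho> v ! i) = col (root_path T \<rho> v ! Suc i)"
proof -
  define follows where "follows x \<longleftrightarrow> (\<forall>i. Suc i < length (root_path T \<rho> x) \<longrightarrow>
       f (root_path T \<rho> x ! i) = col (root_path T \<rho> x ! Suc i))" for x
  define len where "len x = length (root_path T \<rho> x)" for x
  let ?X = "{x \<in> uverts T. follows x}"
  have fin: "finite (uverts T)" and \<rho>: "\<rho> \<in> uverts T"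
    using T by (auto simp: uniquely_rooted_def simple_graph_def)
  have "\<rho> \<in> ?X" using \<rho> by (simp add: follows_def root_path_root[OF T])
  moreover have "finite ?X" using fin by simp
  \<comment> \<open>Among the vertices reached by following the choices, take one farthest from the root.\<close>
  ultimately have "Max (len ` ?X) \<in> len ` ?X" by (intro Max_in) auto
  then obtain x where x: "x \<in> ?X" "Max (len ` ?X) = len x" by blast
  then have max: "len y \<le> len x" if "y \<in> ?X" for y
    using Max_ge[of "len ` ?X" "len y"] \<open>finite ?X\<close> that by simp
  have "x \<in> leaves T \<rho>"
  proof (rule ccontr)
    assume "x \<notin> leaves T \<rho>"
    then have "f x \<in> col ` edge_labels T \<rho> x" using lists x by (simp add: internals_def)
    then obtain y where y: "y \<in> edge_labels T \<rho> x" "f x = col y" by blast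
    have upx: "upath T \<rho> (root_path T \<rho> x) x" using upath_root_path[OF T] x by simp
    then have nx: "root_path T \<rho> x \<noteq> []" "last (root_path T \<rho> x) = x" by (auto simp: upath_def)
    show False
    proof (cases "y \<in> children T \<rho> x")
      case True
      then have y': "y \<in> uverts T" "y \<noteq> \<rho>" "parent T \<rho> y = x" by (auto simp: children_def)
      have rp: "root_path T \<rho> y = root_path T \<rho> x @ [y]" using root_path_nonroot[OF T y'(1,2)] y' by simp
      have "follows y"
        unfolding follows_def rp
      proof (intro allI impI)
        fix i assume i: "Suc i < length (root_path T \<rho> x @ [y])"
        show "f ((root_path T \<rho> x @ [y]) ! i) = col ((root_path T \<rho> x @ [y]) ! Suc i)"
        proof (cases "Suc i < length (root_path T \<rho> x)")
          case True
          then show ?thesis using x by (simp add: follows_def nth_append)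
        next
          case False
          then have "length (root_path T \<rho> x) = Suc i" using i by simp
          then show ?thesis using nx y(2) by (simp add: nth_append last_conv_nth)
        qed
      qed
      then show False using max[of y] y' rp by (simp add: len_def)
    next
      case False
      then have yx: "y = x" "x \<noteq> \<rho>" using y(1) by (auto simp: edge_labels_def)
      have xV: "x \<in> uverts T" using x by simp
      let ?q = "root_path T \<rho> (parent T \<rho> x)"
      have rp: "root_path T \<rho> x = ?q @ [x]" using root_path_nonroot[OF T xV yx(2)] .
      have "upath T \<rho> ?q (parent T \<rho> x)"
        using upath_root_path[OF T parent_in[OF T xV yx(2)]] .
      then have q: "?q \<noteq> []" "?q ! (length ?q - 1) = parent T \<rho> x"
        by (auto simp: upath_def last_conv_nth)
      have "follows x" using x by simp
      then have "f (parent T \<rho> x) = col x"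
        using q unfolding follows_def rp
        by (auto simp: nth_append dest!: spec[of _ "length ?q - 1"])
      then show False using proper[OF parent_edge[OF T xV yx(2)]] y(2) yx(1) by simp
    qed
  qed
  then show ?thesis using that x by (auto simp: follows_def)
qed


section \<open>Attaching the copies\<close>

text \<open>
  A single vertex can be coloured from any nonempty list.  Applied to \<open>G\<^sub>k\<^sub>-\<^sub>1\<close>, this shows that every leaf of
  the augmented tree has at least one augmenting edge.
\<close>

lemma not_list_colorable_nontrivial:
  assumes fin: "finite (uverts G)" and bip: "bipartition G A B" and \<rho>: "\<rho> \<in> uverts G"
    and L: "list_assignment k G L" "0 < k" and nc: "\<not> list_colorable G L"
  shows "1 < card (uverts G)"
proof (rule ccontr)
  assume "\<not> 1 < card (uverts G)"
  then have V: "uverts G = {\<rho>}"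
    using fin \<rho> card_le_Suc0_iff_eq[OF fin] by auto
  have "L \<rho> \<noteq> {}" using L \<rho> by (auto simp: list_assignment_def)
  then obtain c where "c \<in> L \<rho>" by blast
  moreover have "{\<rho>} \<notin> uedges G" using bip by (fastforce simp: bipartition_def)
  ultimately have "list_colorable G L"
    unfolding list_colorable_def proper_coloring_def V by (intro exI[of _ "\<lambda>_. c"]) auto
  then show False using nc by simp
qed

text \<open>
  The step of the construction.  Inside a copy the extra colours are fresh and differ on adjacent vertices,
  so adjacent lists still meet in a single old colour; between the copy and the tree they meet exactly
  in the extra colour.
\<close>

lemma attach_copies_not_list_colorable:
  fixes L' :: "'a \<Rightarrow> nat set"
  assumes k: "3 \<le> k" and fin': "finite (uverts G')" and bip: "bipartition G' A B" and \<rho>': "\<rho>' \<in> A"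
    and L': "list_assignment (k - 1) G' L'"
    and L'edge: "\<And>x y. {x, y} \<in> uedges G' \<Longrightarrow> card (L' x \<inter> L' y) = 1"
    and nc': "\<not> list_colorable G' L'"
    and red: "reduced_drg_graph k (card (uverts G') - 1) g T \<rho> N"
    and att: "attach_copies G' \<rho>' A B T \<rho> N G"
  shows "finite (uverts G)"
    and "\<exists>L :: 'a \<Rightarrow> nat set. list_assignment k G L \<and>
           (\<forall>u v. {u, v} \<in> uedges G \<longrightarrow> card (L u \<inter> L v) = 1) \<and> \<not> list_colorable G L"
proof -
  define V' where "V' = uverts G'"
  have AB: "A \<union> B = V'" "A \<inter> B = {}" using bip by (auto simp: bipartition_def V'_def)
  have \<rho>V: "\<rho>' \<in> V'" "\<rho>' \<notin> B" using AB \<rho>' by auto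
  have "1 < card (uverts G')"
    using not_list_colorable_nontrivial[OF fin' bip _ L' _ nc'] \<rho>V k by (simp add: V'_def)
  then have r: "0 < card (uverts G') - 1" by simp
  note T = reduced_drg_graph_structure(1)[OF red k r]
  note \<rho>int = reduced_drg_graph_structure(2)[OF red k r]
  note tree = reduced_drg_graph_structure(3-5)[OF red k r]
  have finT: "finite (uverts T)" using T by (simp add: uniquely_rooted_def simple_graph_def)
  obtain \<phi> SA SB \<alpha> \<beta> where
    copies': "\<forall>v\<in>leaves T \<rho>. inj_on (\<phi> v) V' \<and> \<phi> v \<rho>' = v \<and>
        \<phi> v ` (V' - {\<rho>'}) \<inter> uverts T = {} \<and> SA v \<subseteq> N v \<and> card (SA v) = card A - 1 \<and>
        SB v = step_towards T \<rho> v ` (N v - SA v) \<and>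
        bij_betw (\<alpha> v) (A - {\<rho>'}) (SA v) \<and> bij_betw (\<beta> v) B (SB v)"
    and disj: "\<forall>v\<in>leaves T \<rho>. \<forall>w\<in>leaves T \<rho>. v \<noteq> w \<longrightarrow> \<phi> v ` V' \<inter> \<phi> w ` V' = {}"
    and G: "G = (uverts T \<union> (\<Union>v\<in>leaves T \<rho>. \<phi> v ` V'),
             uedges T \<union>
             (\<Union>v\<in>leaves T \<rho>. (\<lambda>e. \<phi> v ` e) ` uedges G' \<union>
                {{\<phi> v x, \<alpha> v x} |x. x \<in> A - {\<rho>'}} \<union> {{\<phi> v y, \<beta> v y} |y. y \<in> B}))"
  proof -
    show thesis
      using att[unfolded attach_copies_def, folded V'_def]
      by (elim exE conjE) (rule that; assumption)
  qed
  note copies = copies'[rule_format]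
  have \<alpha>_in: "\<alpha> v x \<in> N v" if "v \<in> leaves T \<rho>" "x \<in> A - {\<rho>'}" for v x
  proof -
    have "bij_betw (\<alpha> v) (A - {\<rho>'}) (SA v)" "SA v \<subseteq> N v" using copies[OF that(1)] by blast+
    then show ?thesis using bij_betwE that(2) by blast
  qed
  have \<beta>_in: "\<beta> v y \<in> step_towards T \<rho> v ` N v" if "v \<in> leaves T \<rho>" "y \<in> B" for v y
  proof -
    have "bij_betw (\<beta> v) B (SB v)" "SB v = step_towards T \<rho> v ` (N v - SA v)"
      using copies[OF that(1)] by blast+
    then show ?thesis using bij_betwE that(2) by blast
  qed
  have leafV: "v \<in> uverts T" "v \<noteq> \<rho>" if "v \<in> leaves T \<rho>" for v
    using that \<rho>int by (auto simp: leaves_def internals_def)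
  have "finite (leaves T \<rho>)" using finT by (simp add: leaves_def)
  then show "finite (uverts G)" using finT fin' by (simp add: G V'_def)

  \<comment> \<open>The neighbour of \<open>\<phi> v x\<close> on the full path to \<open>v\<close> outside the copy, and the (name of the) path edge
    below it, whose colour is added to the list of \<open>\<phi> v x\<close>.  For the root of the copy, which is the leaf
    \<open>v\<close>, these are the parent of \<open>v\<close> and the edge to it.\<close>
  define upper where "upper v x =
    (if x = \<rho>' then parent T \<rho> v else if x \<in> A then \<alpha> v x else \<beta> v x)" for v x
  define lab where "lab v x = (if x = \<rho>' then v else step_towards T \<rho> v (upper v x))" for v x
  \<comment> \<open>The parity of the depth of the outer neighbour tells the two classes of the copy apart.  Three
    steps of room below the endpoints of augmenting edges leave a path edge below the shifted ones as well.\<close>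
  have position: "\<exists>i. Suc i < length (root_path T \<rho> v) \<and> upper v x = root_path T \<rho> v ! i \<and>
       lab v x = root_path T \<rho> v ! Suc i \<and> (x \<in> A \<longleftrightarrow> even (length (root_path T \<rho> v) + i))"
    if v: "v \<in> leaves T \<rho>" and x: "x \<in> V'" for v x
  proof -
    let ?p = "root_path T \<rho> v"
    note vV = leafV[OF v]
    consider "x = \<rho>'" | "x \<in> A - {\<rho>'}" | "x \<in> B" using x AB by auto
    then show ?thesis
    proof cases
      case 1
      let ?q = "root_path T \<rho> (parent T \<rho> v)"
      have "upath T \<rho> ?q (parent T \<rho> v)"
        by (rule upath_root_path[OF T parent_in[OF T vV]])
      then obtain n where n: "length ?q = Suc n" "?q ! n = parent T \<rho> v"
        by (cases "length ?q") (auto simp: upath_def last_conv_nth)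
      have "?p = ?q @ [v]" by (rule root_path_nonroot[OF T vV])
      then show ?thesis using n 1 \<rho>' by (intro exI[of _ n]) (simp add: upper_def lab_def nth_append)
    next
      case 2
      then have "\<alpha> v x \<in> N v" using \<alpha>_in[OF v] by blast
      then obtain i where i: "\<alpha> v x = ?p ! i" "i + 3 < length ?p" "even (length ?p + i)"
        using tree(3)[OF v] by blast
      then have "step_towards T \<rho> v (\<alpha> v x) = ?p ! Suc i" using step_towards_nth[OF T vV(1), of i] by simp
      then show ?thesis using i 2 by (intro exI[of _ i]) (simp add: upper_def lab_def)
    next
      case 3
      then have xA: "x \<notin> A" "x \<noteq> \<rho>'" using AB \<rho>V by auto
      have "\<beta> v x \<in> step_towards T \<rho> v ` N v" using \<beta>_in[OF v 3] .
      then obtain u where u: "u \<in> N v" "\<beta> v x = step_towards T \<rho> v u" by blast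
      obtain i where i: "u = ?p ! i" "i + 3 < length ?p" "even (length ?p + i)"
        using tree(3)[OF v u(1)] by blast
      have "\<beta> v x = ?p ! Suc i" using u i step_towards_nth[OF T vV(1), of i] by simp
      moreover from this have "step_towards T \<rho> v (\<beta> v x) = ?p ! Suc (Suc i)"
        using i step_towards_nth[OF T vV(1), of "Suc i"] by simp
      ultimately show ?thesis using i xA by (intro exI[of _ "Suc i"]) (simp add: upper_def lab_def)
    qed
  qed
  have lab_child: "lab v x \<in> children T \<rho> (upper v x)" if "v \<in> leaves T \<rho>" "x \<in> V'" for v x
    using position[OF that] root_path_parent_nth[OF T leafV(1)[OF that(1)]] by auto
  have upper_internal: "upper v x \<in> internals T \<rho>" if "v \<in> leaves T \<rho>" "x \<in> V'" for v x
    using lab_child[OF that] parent_in[OF T, of "lab v x"]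
    by (auto simp: internals_def leaves_def children_def)
  have labV: "lab v x \<in> uverts T" if "v \<in> leaves T \<rho>" "x \<in> V'" for v x
    using lab_child[OF that] by (auto simp: children_def)
  have lab_neq: "lab v x \<noteq> lab v y" if v: "v \<in> leaves T \<rho>" and x: "x \<in> A" and y: "y \<in> B" for v x y
  proof -
    let ?p = "root_path T \<rho> v"
    have xy: "x \<in> V'" "y \<in> V'" "y \<notin> A" using x y AB by auto
    obtain i where i: "Suc i < length ?p" "lab v x = ?p ! Suc i" "even (length ?p + i)"
      using position[OF v xy(1)] x by blast
    obtain j where j: "Suc j < length ?p" "lab v y = ?p ! Suc j" "odd (length ?p + j)"
      using position[OF v xy(2)] xy(3) by blast
    have "i \<noteq> j" using i(3) j(3) by auto
    moreover have "distinct ?p" using upath_root_path[OF T leafV(1)[OF v]] by (simp add: upath_def)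
    ultimately show ?thesis using i j by (simp add: nth_eq_iff_index_eq)
  qed
  have copy_edge: "\<phi> v ` e \<in> uedges G" if "v \<in> leaves T \<rho>" "e \<in> uedges G'" for v e
    unfolding G snd_conv by (intro UnI2 UN_I[OF that(1)] UnI1 imageI that(2))
  have upper_edge: "{\<phi> v x, upper v x} \<in> uedges G" if "v \<in> leaves T \<rho>" "x \<in> V'" for v x
  proof -
    have "{v, parent T \<rho> v} \<in> uedges T"
      using parent_edge[OF T leafV[OF that(1)]] by (simp add: insert_commute)
    then show ?thesis using that copies[OF that(1)] AB by (auto simp: upper_def G)
  qed

  have finL': "finite (L' x)" "card (L' x) = k - 1" if "x \<in> V'" for x
    using L' that by (auto simp: list_assignment_def V'_def)
  then have "finite (\<Union>x\<in>V'. L' x)" using fin' by (simp add: V'_def)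
  then obtain M where "\<And>c. c \<in> (\<Union>x\<in>V'. L' x) \<Longrightarrow> c < M" by (auto simp: finite_nat_set_iff_bounded)
  then have M: "\<And>x c. x \<in> V' \<Longrightarrow> c \<in> L' x \<Longrightarrow> c < M" by auto
  obtain enum :: "'a \<Rightarrow> nat" where enum: "inj_on enum (uverts T)"
    using finite_imp_inj_to_nat_seg[OF finT] by blast
  \<comment> \<open>One colour for each tree edge, all above the colours of the copies.\<close>
  define col where "col y = M + enum y" for y
  have col_inj: "inj_on col (uverts T)" using enum by (simp add: col_def inj_on_def)
  have col_fresh: "col y \<notin> L' x" if "x \<in> V'" for x y using M[OF that, of "col y"] by (auto simp: col_def)

  \<comment> \<open>The copies are disjoint, so a vertex of a copy determines its leaf and its preimage.\<close>
  let ?S = "leaves T \<rho> \<times> V'" and ?F = "\<lambda>(v, x). \<phi> v x"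
  define L where "L z = (if z \<in> internals T \<rho> then col ` edge_labels T \<rho> z
    else case inv_into ?S ?F z of (v, x) \<Rightarrow> insert (col (lab v x)) (L' x))" for z
  have F_inj: "inj_on ?F ?S"
  proof (rule inj_onI, clarify)
    fix v x w y assume *: "v \<in> leaves T \<rho>" "w \<in> leaves T \<rho>" "x \<in> V'" "y \<in> V'" "\<phi> v x = \<phi> w y"
    then have "v = w" using disj by (metis IntI empty_iff imageI)
    then show "v = w \<and> x = y" using copies[of v] * by (auto dest: inj_onD)
  qed
  have L_int: "L z = col ` edge_labels T \<rho> z" if "z \<in> internals T \<rho>" for z
    using that by (simp add: L_def)
  have L_copy: "L (\<phi> v x) = insert (col (lab v x)) (L' x)" if v: "v \<in> leaves T \<rho>" and x: "x \<in> V'" for v x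
  proof -
    have "\<phi> v x \<notin> internals T \<rho>"
      using copies[OF v] v x by (cases "x = \<rho>'") (auto simp: internals_def)
    then show ?thesis using inv_into_f_f[OF F_inj, of "(v, x)"] v x by (simp add: L_def)
  qed
  have labels_V: "edge_labels T \<rho> u \<subseteq> uverts T" if "u \<in> uverts T" for u
    using that by (auto simp: edge_labels_def children_def)
  have L_upper: "L (upper v x) \<inter> L (\<phi> v x) = {col (lab v x)}" if "v \<in> leaves T \<rho>" "x \<in> V'" for v x
    using L_int[OF upper_internal[OF that]] L_copy[OF that] lab_child[OF that] col_fresh[OF that(2)]
    by (auto simp: edge_labels_def)

  have "list_assignment k G L"
    unfolding list_assignment_def
  proof
    fix z assume z: "z \<in> uverts G"
    consider "z \<in> internals T \<rho>" | v x where "v \<in> leaves T \<rho>" "x \<in> V'" "z = \<phi> v x"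
      using z copies \<rho>V by (fastforce simp: G internals_def)
    then show "finite (L z) \<and> card (L z) = k"
    proof cases
      case 1
      then have zV: "z \<in> uverts T" by (simp add: internals_def)
      have "card (edge_labels T \<rho> z) = k"
        using card_edge_labels[OF T] tree(1,2) 1 k by simp
      moreover have "inj_on col (edge_labels T \<rho> z)"
        using col_inj labels_V[OF zV] by (rule inj_on_subset)
      moreover have "finite (edge_labels T \<rho> z)" using labels_V[OF zV] finT by (rule finite_subset)
      ultimately show ?thesis by (simp add: L_int[OF 1] card_image)
    next
      case 2
      then show ?thesis using L_copy[OF 2(1,2)] finL'[OF 2(2)] col_fresh[OF 2(2)] k by simp
    qed
  qed
  moreover have "card (L u \<inter> L w) = 1" if uw: "{u, w} \<in> uedges G" for u w
  proof -
    \<comment> \<open>A property of the edge as a set, so that the order of its ends does not matter.\<close>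
    define meet where "meet e \<longleftrightarrow> (\<exists>x y. e = {x, y} \<and> card (L x \<inter> L y) = 1)" for e
    have meet_tree: "meet e" if e: "e \<in> uedges T" for e
    proof -
      obtain y where y: "y \<in> uverts T" "y \<noteq> \<rho>" "e = {parent T \<rho> y, y}"
        using edge_parent_child[OF T e] by blast
      show ?thesis
      proof (cases "y \<in> leaves T \<rho>")
        case True
        have "upper y \<rho>' = parent T \<rho> y" "\<phi> y \<rho>' = y" using copies[OF True] by (simp_all add: upper_def)
        then show ?thesis using L_upper[OF True \<rho>V(1)] y unfolding meet_def
          by (intro exI[of _ "parent T \<rho> y"] exI[of _ y]) simp
      next
        case False
        have "parent T \<rho> y \<in> internals T \<rho>" "y \<in> internals T \<rho>"
          using False y parent_in[OF T y(1,2)] by (auto simp: internals_def leaves_def children_def)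
        then have "L (parent T \<rho> y) \<inter> L y =
            col ` (edge_labels T \<rho> (parent T \<rho> y) \<inter> edge_labels T \<rho> y)"
          using inj_on_image_Int[OF col_inj labels_V labels_V] parent_in[OF T y(1,2)] y(1)
          by (simp add: L_int)
        also have "\<dots> = {col y}" by (simp add: edge_labels_Int_parent[OF T y(1,2)])
        finally show ?thesis using y(3) unfolding meet_def
          by (intro exI[of _ "parent T \<rho> y"] exI[of _ y]) simp
      qed
    qed
    have meet_upper: "meet {\<phi> v x, upper v x}" if "v \<in> leaves T \<rho>" "x \<in> V'" for v x
      using L_upper[OF that] unfolding meet_def
      by (intro exI[of _ "upper v x"] exI[of _ "\<phi> v x"]) (auto simp: insert_commute)
    have meet_copy: "meet (\<phi> v ` e)" if v: "v \<in> leaves T \<rho>" and e: "e \<in> uedges G'" for v e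
    proof -
      obtain x y where xy: "e = {x, y}" "x \<in> A" "y \<in> B" using bip e by (auto simp: bipartition_def)
      have V: "x \<in> V'" "y \<in> V'" using xy AB by auto
      have "col (lab v x) \<noteq> col (lab v y)"
        using lab_neq[OF v xy(2,3)] col_inj labV[OF v V(1)] labV[OF v V(2)] by (auto dest: inj_onD)
      then have "L (\<phi> v x) \<inter> L (\<phi> v y) = L' x \<inter> L' y"
        using col_fresh V by (auto simp: L_copy[OF v])
      then show ?thesis using L'edge[of x y] e xy(1) unfolding meet_def
        by (intro exI[of _ "\<phi> v x"] exI[of _ "\<phi> v y"]) simp
    qed
    have "meet {u, w}"
    proof -
      consider "{u, w} \<in> uedges T"
        | v e where "v \<in> leaves T \<rho>" "e \<in> uedges G'" "{u, w} = \<phi> v ` e"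
        | v x where "v \<in> leaves T \<rho>" "x \<in> A - {\<rho>'}" "{u, w} = {\<phi> v x, \<alpha> v x}"
        | v y where "v \<in> leaves T \<rho>" "y \<in> B" "{u, w} = {\<phi> v y, \<beta> v y}"
        using uw unfolding G by auto
      then show ?thesis
      proof cases
        case (3 v x)
        moreover have "upper v x = \<alpha> v x" using 3 by (simp add: upper_def)
        ultimately show ?thesis using meet_upper[of v x] AB by auto
      next
        case (4 v y)
        moreover have "upper v y = \<beta> v y" using 4 AB \<rho>V by (auto simp: upper_def)
        ultimately show ?thesis using meet_upper[of v y] AB by auto
      qed (use meet_tree meet_copy in auto)
    qed
    then show ?thesis unfolding meet_def by (auto simp: doubleton_eq_iff Int_commute)
  qed
  moreover have "\<not> list_colorable G L"
  proof
    assume "list_colorable G L"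
    then obtain f where proper: "proper_coloring G f" and fL: "\<And>z. z \<in> uverts G \<Longrightarrow> f z \<in> L z"
      by (auto simp: list_colorable_def)
    have TG: "uverts T \<subseteq> uverts G" "uedges T \<subseteq> uedges G" by (auto simp: G)
    have sub: "u \<in> uverts T \<and> w \<in> uverts T" if "{u, w} \<in> uedges T" for u w
      using T that by (auto simp: uniquely_rooted_def simple_graph_def)
    have "f u \<noteq> f w" if "{u, w} \<in> uedges T" for u w
      using proper sub[OF that] that TG unfolding proper_coloring_def by blast
    moreover have "f u \<in> col ` edge_labels T \<rho> u" if "u \<in> internals T \<rho>" for u
      using fL[of u] L_int[OF that] TG that by (auto simp: internals_def)
    ultimately obtain v where v: "v \<in> leaves T \<rho>"
      and follow: "\<And>i. Suc i < length (root_path T \<rho> v) \<Longrightarrow>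
         f (root_path T \<rho> v ! i) = col (root_path T \<rho> v ! Suc i)"
      using coloring_follows_full_path[OF T] by metis
    have VG: "\<phi> v x \<in> uverts G" if "x \<in> V'" for x using v that by (auto simp: G)
    have f_copy: "f (\<phi> v x) \<in> L' x" if x: "x \<in> V'" for x
    proof -
      have "f (upper v x) = col (lab v x)" using position[OF v x] follow by auto
      moreover have "upper v x \<in> uverts G" using upper_internal[OF v x] TG by (auto simp: internals_def)
      then have "f (\<phi> v x) \<noteq> f (upper v x)"
        using proper upper_edge[OF v x] VG[OF x] unfolding proper_coloring_def by blast
      ultimately show ?thesis using fL[OF VG[OF x]] L_copy[OF v x] by auto
    qed
    have "proper_coloring G' (f \<circ> \<phi> v)"
      unfolding proper_coloring_def
    proof (intro ballI impI)
      fix x y assume xy: "x \<in> uverts G'" "y \<in> uverts G'" "{x, y} \<in> uedges G'"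
      then have "{\<phi> v x, \<phi> v y} \<in> uedges G" using copy_edge[OF v, of "{x, y}"] by simp
      then show "(f \<circ> \<phi> v) x \<noteq> (f \<circ> \<phi> v) y"
        using proper VG xy unfolding proper_coloring_def V'_def by auto
    qed
    then have "list_colorable G' L'"
      using f_copy unfolding list_colorable_def V'_def by (intro exI[of _ "f \<circ> \<phi> v"]) simp
    then show False using nc' by simp
  qed
  ultimately show "\<exists>L :: 'a \<Rightarrow> nat set. list_assignment k G L \<and>
      (\<forall>u v. {u, v} \<in> uedges G \<longrightarrow> card (L u \<inter> L v) = 1) \<and> \<not> list_colorable G L"
    by blast
qed


section \<open>Two cycles sharing a vertex\<close>

lemma cycle_edges_rotate1: "cycle_edges (rotate1 c) = cycle_edges c"
proof (cases "c = []")
  case False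
  let ?n = "length c" and ?E = "\<lambda>i. {c ! i, c ! (Suc i mod length c)}"
  have surj: "(\<lambda>i. Suc i mod ?n) ` {..<?n} = {..<?n}"
  proof
    show "{..<?n} \<subseteq> (\<lambda>i. Suc i mod ?n) ` {..<?n}"
    proof
      fix j assume j: "j \<in> {..<?n}"
      show "j \<in> (\<lambda>i. Suc i mod ?n) ` {..<?n}"
      proof (cases j)
        case 0
        then show ?thesis using False by (intro image_eqI[of _ _ "?n - 1"]) simp_all
      next
        case (Suc i)
        then show ?thesis using j by (intro image_eqI[of _ _ i]) simp_all
      qed
    qed
  qed (use False in auto)
  have img: "cycle_edges c' = (\<lambda>i. {c' ! i, c' ! (Suc i mod length c')}) ` {..<length c'}" for c' :: "'a list"
    by (auto simp: cycle_edges_def)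
  have "cycle_edges (rotate1 c) = (\<lambda>i. ?E (Suc i mod ?n)) ` {..<?n}"
    unfolding img length_rotate1 using False by (intro image_cong refl) (simp add: nth_rotate1)
  also have "\<dots> = ?E ` ((\<lambda>i. Suc i mod ?n) ` {..<?n})" by (simp add: image_image)
  also have "\<dots> = cycle_edges c" by (simp only: surj img)
  finally show ?thesis .
qed simp

lemma cycle_starting_at:
  assumes "distinct c" "\<rho> \<in> set c"
  obtains d where "distinct (\<rho> # d)" "length c = Suc (length d)" "set c = set (\<rho> # d)"
    "cycle_edges c = cycle_edges (\<rho> # d)"
proof -
  obtain xs ys where c: "c = xs @ \<rho> # ys" using assms(2) by (meson split_list)
  have "cycle_edges (rotate m c) = cycle_edges c" for m
    by (induction m) (simp_all add: cycle_edges_rotate1)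
  moreover have "rotate (length xs) c = \<rho> # ys @ xs" by (simp add: c rotate_append)
  ultimately have "cycle_edges c = cycle_edges (\<rho> # ys @ xs)" by metis
  then show ?thesis using that[of "ys @ xs"] assms(1) by (auto simp: c)
qed

lemma cycle_edges_Cons:
  assumes "d \<noteq> []"
  shows "cycle_edges (\<rho> # d) =
    {{\<rho>, d ! 0}, {\<rho>, last d}} \<union> {{d ! i, d ! Suc i} |i. Suc i < length d}"
proof -
  have "cycle_edges (\<rho> # d) = (\<lambda>i. {(\<rho> # d) ! i, (\<rho> # d) ! (Suc i mod Suc (length d))}) ` {..length d}"
    by (auto simp: cycle_edges_def less_Suc_eq_le)
  also have "{..length d} = insert 0 (insert (length d) (Suc ` {i. Suc i < length d}))"
    using assms by (auto simp: image_iff) (metis Suc_lessI gr0_implies_Suc le_imp_less_or_eq neq0_conv)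
  also have "(\<lambda>i. {(\<rho> # d) ! i, (\<rho> # d) ! (Suc i mod Suc (length d))}) ` \<dots> =
      {{\<rho>, d ! 0}, {\<rho>, last d}} \<union> {{d ! i, d ! Suc i} |i. Suc i < length d}"
    using assms by (auto simp: nth_Cons' last_conv_nth insert_commute image_image)
  finally show ?thesis .
qed

text \<open>
  The lists on \<open>d\<close> run through \<open>{b, b + 1}, {b + 1, b + 2}, \<dots>\<close> and close up cyclically with \<open>b\<close>.  At
  least three colours are needed, for otherwise adjacent lists would coincide.
\<close>

lemma cyclic_lists_edges:
  assumes "3 \<le> length d" "b \<in> L \<rho>" "L \<rho> \<inter> {b..<b + length d} \<subseteq> {b}"
    and L: "\<And>i. i < length d \<Longrightarrow> L (d ! i) = {b + i, b + Suc i mod length d}"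
    and uv: "{u, v} \<in> cycle_edges (\<rho> # d)"
  shows "card (L u \<inter> L v) = (1 :: nat)"
proof -
  let ?n = "length d"
  have "d \<noteq> []" using assms(1) by auto
  then have ne: "d \<noteq> []" "d ! (?n - 1) = last d" by (simp_all add: last_conv_nth)
  have "L (d ! 0) = {b, Suc b}" using L[of 0] assms(1) ne by simp
  then have "b \<in> L (d ! 0)" "L (d ! 0) \<subseteq> {b..<b + ?n}" using assms(1) by auto
  then have first: "L \<rho> \<inter> L (d ! 0) = {b}" using assms(2,3) by blast
  have "L (last d) = {b + (?n - 1), b}" using L[of "?n - 1"] ne by simp
  then have "b \<in> L (last d)" "L (last d) \<subseteq> {b..<b + ?n}" using assms(1) by auto
  then have last: "L \<rho> \<inter> L (last d) = {b}" using assms(2,3) by blast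
  have mid: "L (d ! i) \<inter> L (d ! Suc i) = {b + Suc i}" if i: "Suc i < ?n" for i
  proof -
    have "Suc (Suc i) mod ?n \<noteq> i"
      using i assms(1) by (cases "Suc (Suc i) = ?n") auto
    then show ?thesis using L[of i] L[of "Suc i"] i by auto
  qed
  have "\<exists>x y. {u, v} = {x, y} \<and> card (L x \<inter> L y) = 1"
  proof -
    consider "{u, v} = {\<rho>, d ! 0}" | "{u, v} = {\<rho>, last d}"
      | i where "Suc i < ?n" "{u, v} = {d ! i, d ! Suc i}"
      using uv unfolding cycle_edges_Cons[OF ne(1)] by blast
    then show ?thesis
    proof cases
      case 1
      then show ?thesis using first by (intro exI[of _ \<rho>] exI[of _ "d ! 0"]) simp
    next
      case 2
      then show ?thesis using last by (intro exI[of _ \<rho>] exI[of _ "last d"]) simp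
    next
      case (3 i)
      then show ?thesis using mid[OF 3(1)] by (intro exI[of _ "d ! i"] exI[of _ "d ! Suc i"]) simp
    qed
  qed
  then show ?thesis by (auto simp: doubleton_eq_iff Int_commute)
qed

text \<open>
  If the root has colour \<open>b\<close>, every vertex of \<open>d\<close> in turn must take the second colour of its list, and for the last
  vertex, which is adjacent to the root, this is \<open>b\<close> again.
\<close>

lemma cyclic_lists_exclude:
  assumes "3 \<le> length d"
    and L: "\<And>i. i < length d \<Longrightarrow> f (d ! i) \<in> {b + i, b + Suc i mod length d}"
    and f: "\<And>u v. {u, v} \<in> cycle_edges (\<rho> # d) \<Longrightarrow> f u \<noteq> f v"
  shows "f \<rho> \<noteq> (b :: nat)"
proof
  assume \<rho>: "f \<rho> = b"
  let ?n = "length d"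
  have ne: "d \<noteq> []" using assms(1) by auto
  have "f (d ! i) = b + Suc i mod ?n" if "i < ?n" for i
    using that
  proof (induction i)
    case 0
    then show ?case using L[of 0] f[of \<rho> "d ! 0"] \<rho> by (auto simp: cycle_edges_Cons[OF ne])
  next
    case (Suc i)
    then have "f (d ! i) \<noteq> f (d ! Suc i)" by (intro f) (auto simp: cycle_edges_Cons[OF ne])
    then show ?case using Suc L[of "Suc i"] by auto
  qed
  from this[of "?n - 1"] have "f (last d) = b" using ne by (simp add: last_conv_nth)
  moreover have "f \<rho> \<noteq> f (last d)" by (intro f) (simp add: cycle_edges_Cons[OF ne])
  ultimately show False using \<rho> by simp
qed

text \<open>
  The two cycles use the disjoint colour sets \<open>{0..<n}\<close> and \<open>{n..<2 * n}\<close>, where \<open>n = g - 1\<close>, and exclude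
  the colours \<open>0\<close> and \<open>n\<close> at the root, which are its whole list.
\<close>

lemma two_cycles_not_list_colorable:
  fixes G :: "'a ugraph"
  assumes G: "two_cycles g G \<rho>" and g: "4 \<le> g"
  shows "finite (uverts G)"
    and "\<exists>L :: 'a \<Rightarrow> nat set. list_assignment 2 G L \<and>
           (\<forall>u v. {u, v} \<in> uedges G \<longrightarrow> card (L u \<inter> L v) = 1) \<and> \<not> list_colorable G L"
proof -
  obtain c1 c2 where c: "length c1 = g" "length c2 = g" "distinct c1" "distinct c2"
      "set c1 \<inter> set c2 = {\<rho>}" "G = (set c1 \<union> set c2, cycle_edges c1 \<union> cycle_edges c2)"
    using G by (auto simp: two_cycles_def)
  have "\<rho> \<in> set c1" "\<rho> \<in> set c2" using c(5) by auto
  obtain d where d: "distinct (\<rho> # d)" "length c1 = Suc (length d)" "set c1 = set (\<rho> # d)"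
      "cycle_edges c1 = cycle_edges (\<rho> # d)"
    using cycle_starting_at[OF c(3) \<open>\<rho> \<in> set c1\<close>] .
  obtain e where e: "distinct (\<rho> # e)" "length c2 = Suc (length e)" "set c2 = set (\<rho> # e)"
      "cycle_edges c2 = cycle_edges (\<rho> # e)"
    using cycle_starting_at[OF c(4) \<open>\<rho> \<in> set c2\<close>] .
  define n where "n = g - 1"
  have n: "3 \<le> n" "length d = n" "length e = n" using c d(2) e(2) g by (simp_all add: n_def)
  have disj: "set d \<inter> set e = {}" using c(5) d(1,3) e(1,3) by auto
  have V: "uverts G = insert \<rho> (set d \<union> set e)"
    and E: "uedges G = cycle_edges (\<rho> # d) \<union> cycle_edges (\<rho> # e)"
    using c(6) d(3,4) e(3,4) by auto
  show "finite (uverts G)" by (simp add: V)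
  define cyc where "cyc b i = {b + i, b + Suc i mod n}" for b i
  define L where "L z = (if z = \<rho> then {0, n}
      else if z \<in> set d then cyc 0 (inv_into {..<n} ((!) d) z)
      else cyc n (inv_into {..<n} ((!) e) z))" for z
  have inj: "inj_on ((!) d) {..<n}" "inj_on ((!) e) {..<n}"
    using d(1) e(1) n by (auto simp: inj_on_def nth_eq_iff_index_eq)
  have L\<rho>: "L \<rho> = {0, n}" by (simp add: L_def)
  have Ld: "L (d ! i) = cyc 0 i" if "i < n" for i
  proof -
    have "d ! i \<in> set d" using that n(2) by simp
    moreover have "inv_into {..<n} ((!) d) (d ! i) = i" using inv_into_f_f[OF inj(1)] that by simp
    moreover have "d ! i \<noteq> \<rho>" using calculation(1) d(1) by auto
    ultimately show ?thesis by (simp add: L_def)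
  qed
  have Le: "L (e ! i) = cyc n i" if "i < n" for i
  proof -
    have "e ! i \<in> set e" using that n(3) by simp
    moreover have "inv_into {..<n} ((!) e) (e ! i) = i" using inv_into_f_f[OF inj(2)] that by simp
    moreover have "e ! i \<noteq> \<rho>" "e ! i \<notin> set d" using calculation(1) e(1) disj by auto
    ultimately show ?thesis by (simp add: L_def)
  qed
  have card_cyc: "card (cyc b i) = 2" "finite (cyc b i)" if "i < n" for b i
    using n(1) that by (cases "Suc i = n"; simp add: cyc_def)+
  have "list_assignment 2 G L"
    unfolding list_assignment_def V
    using card_cyc Ld Le n by (auto simp: L\<rho> in_set_conv_nth)
  moreover have "card (L u \<inter> L v) = 1" if "{u, v} \<in> uedges G" for u v
  proof -
    consider "{u, v} \<in> cycle_edges (\<rho> # d)" | "{u, v} \<in> cycle_edges (\<rho> # e)"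
      using \<open>{u, v} \<in> uedges G\<close> E by auto
    then show ?thesis
    proof cases
      case 1
      then show ?thesis using cyclic_lists_edges[of d 0 L \<rho> u v] n Ld by (auto simp: L\<rho> cyc_def)
    next
      case 2
      then show ?thesis using cyclic_lists_edges[of e n L \<rho> u v] n Le by (auto simp: L\<rho> cyc_def)
    qed
  qed
  moreover have "\<not> list_colorable G L"
  proof
    assume "list_colorable G L"
    then obtain f where proper: "proper_coloring G f" and fL: "\<And>z. z \<in> uverts G \<Longrightarrow> f z \<in> L z"
      by (auto simp: list_colorable_def)
    have in_cycle: "s \<subseteq> set c" if "s \<in> cycle_edges c" for s :: "'a set" and c
    proof -
      obtain i where i: "i < length c" "s = {c ! i, c ! (Suc i mod length c)}"
        using \<open>s \<in> cycle_edges c\<close> by (auto simp: cycle_edges_def)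
      have "0 < length c" using i(1) by linarith
      then have "Suc i mod length c < length c" by (rule mod_less_divisor)
      then show ?thesis using i by (simp add: nth_mem)
    qed
    have f: "f u \<noteq> f v" if "{u, v} \<in> uedges G" for u v
    proof -
      have "{u, v} \<subseteq> set (\<rho> # d) \<or> {u, v} \<subseteq> set (\<rho> # e)"
        using that in_cycle unfolding E by blast
      then have "u \<in> uverts G" "v \<in> uverts G" unfolding V by auto
      then show ?thesis using proper that unfolding proper_coloring_def by blast
    qed
    have fd: "f (d ! i) \<in> cyc 0 i" if "i < n" for i
      using fL[of "d ! i"] Ld[OF that] that n(2) by (simp add: V)
    have fe: "f (e ! i) \<in> cyc n i" if "i < n" for i
      using fL[of "e ! i"] Le[OF that] that n(3) by (simp add: V)
    have "f \<rho> \<noteq> 0"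
      by (rule cyclic_lists_exclude[of d]) (use n fd f in \<open>simp_all add: E cyc_def\<close>)
    moreover have "f \<rho> \<noteq> n"
      by (rule cyclic_lists_exclude[of e]) (use n fe f in \<open>simp_all add: E cyc_def\<close>)
    ultimately show False using fL[of \<rho>] by (auto simp: V L\<rho>)
  qed
  ultimately show "\<exists>L :: 'a \<Rightarrow> nat set. list_assignment 2 G L \<and>
      (\<forall>u v. {u, v} \<in> uedges G \<longrightarrow> card (L u \<inter> L v) = 1) \<and> \<not> list_colorable G L"
    by blast
qed


section \<open>The recursive construction\<close>

lemma construction_not_list_colorable:
  fixes G :: "'a ugraph"
  assumes "construction g k G \<rho>" "4 \<le> g"
  shows "finite (uverts G) \<and> (\<exists>L :: 'a \<Rightarrow> nat set. list_assignment k G L \<and>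
           (\<forall>u v. {u, v} \<in> uedges G \<longrightarrow> card (L u \<inter> L v) = 1) \<and> \<not> list_colorable G L)"
  using assms(1)
proof induction
  case (base G \<rho>)
  show ?case
    using two_cycles_not_list_colorable[OF base assms(2)] by (rule conjI)
next
  case (step k G' \<rho>' A B T \<rho> N G)
  obtain L' :: "'a \<Rightarrow> nat set" where L': "list_assignment (k - 1) G' L'"
      and common: "\<forall>u v. {u, v} \<in> uedges G' \<longrightarrow> card (L' u \<inter> L' v) = 1"
      and nc: "\<not> list_colorable G' L'"
    using step.IH by (elim conjE exE)
  have fin: "finite (uverts G')" using step.IH by (rule conjunct1)
  show ?case
    using attach_copies_not_list_colorable[OF step.hyps(1) fin step.hyps(3,4) L'
        common[rule_format] nc step.hyps(5,6)]
    by (rule conjI)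
qed

theorem theorem3p5:
  fixes g k :: nat and G :: "'a ugraph" and \<rho> :: 'a
  assumes "g mod 6 = 4"
    and "2 \<le> k"
    and "construction g k G \<rho>"
  shows "\<exists>L :: 'a \<Rightarrow> nat set. list_assignment k G L \<and>
           (\<forall>u v. {u, v} \<in> uedges G \<longrightarrow> card (L u \<inter> L v) = 1) \<and>
           \<not> list_colorable G L"
proof -
  have "4 \<le> g" using assms(1) mod_less_eq_dividend[of g 6] by simp
  then show ?thesis using construction_not_list_colorable[OF assms(3)] by simp
qed

end
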